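(* Let $n$, $k$ and $s$ be nonnegative integers. If $n\ge\max\{\frac12(k^2+4)(k+1),\,(k+1)(k-s+2)+2\}$ and $k\ge\max\{s,1\}$, then $$\rho(F^0_{n,k,s})<\sqrt{n(n+s-k-1)}.$$
   Context: Graphs are finite, simple and undirected; $\rho(G)$ is the largest eigenvalue of the adjacency matrix of $G$. For integers $n>k\ge 0$, $a\ge k+1$, $b\ge1$, let $(X,Y)$ be the bipartition of $K_{n,a+b}$ with $|X|=n$, $|Y|=a+b$, let $X_1\subset X$ with $|X_1|=n-k$ and $Y_1\subset Y$ with $|Y_1|=b$. Then $Z_{a,b}$ (depending also on $n,k$) is the graph obtained from $K_{n,a+b}$ by deleting all edges between $X_1$ and $Y_1$, and $Z^0_{a,b}=Z_{a,b}-e$, where $e=uv$ is an edge of $Z_{a,b}$ with $u\in Y\setminus Y_1$ (so $d(u)=n$) and $v\in X_1$ (so $d(v)=a$). Define $F^0_{n,k,s}=Z^0_{n+s-k-1,\,k+1-s}$. *)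

theory Defs
  imports "Jordan_Normal_Form.Spectral_Radius"
begin

type_synonym 'a graph = "'a set \<times> 'a set set"

definition simple_graph :: "'a graph \<Rightarrow> bool" where
  "simple_graph G \<longleftrightarrow>
     finite (fst G) \<and> (\<forall>e\<in>snd G. \<exists>u\<in>fst G. \<exists>v\<in>fst G. u \<noteq> v \<and> e = {u, v})"

definition adjacency_matrix :: "'a set set \<Rightarrow> 'a list \<Rightarrow> real mat" where
  "adjacency_matrix E vs =
     mat (length vs) (length vs) (\<lambda>(i, j). if {vs ! i, vs ! j} \<in> E then 1 else 0)"

(* The enumeration of the vertices is arbitrary: by spectrum_adjacency_matrix_unique below,
   the set of eigenvalues does not depend on it.  The matrix is over the reals, so its spectrum
   is a set of reals and Max is taken in the usual order, not over absolute values. *)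
definition \<rho> :: "'a graph \<Rightarrow> real" where
  "\<rho> G = Max (spectrum (adjacency_matrix (snd G) (SOME vs. distinct vs \<and> set vs = fst G)))"

definition complete_bipartite_edges :: "'a set \<Rightarrow> 'a set \<Rightarrow> 'a set set" where
  "complete_bipartite_edges X Y = {{x, y} | x y. x \<in> X \<and> y \<in> Y}"

definition Z_edges :: "'a set \<Rightarrow> 'a set \<Rightarrow> 'a set \<Rightarrow> 'a set \<Rightarrow> 'a set set" where
  "Z_edges X Y X1 Y1 = complete_bipartite_edges X Y - complete_bipartite_edges X1 Y1"

(* The graph is determined only up to isomorphism, hence a predicate: G is a copy of the graph
   on some vertex sets X, Y with some admissible choice of X1, Y1 and of the edge uv. *)
definition is_Z0 :: "nat \<Rightarrow> nat \<Rightarrow> nat \<Rightarrow> nat \<Rightarrow> 'a graph \<Rightarrow> bool" where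
  "is_Z0 n k a b G \<longleftrightarrow>
     k < n \<and> k + 1 \<le> a \<and> 1 \<le> b \<and>
     (\<exists>X Y X1 Y1 u v.
        finite X \<and> finite Y \<and> X \<inter> Y = {} \<and> card X = n \<and> card Y = a + b \<and>
        X1 \<subseteq> X \<and> card X1 = n - k \<and> Y1 \<subseteq> Y \<and> card Y1 = b \<and>
        u \<in> Y - Y1 \<and> v \<in> X1 \<and>
        G = (X \<union> Y, Z_edges X Y X1 Y1 - {{u, v}}))"

(* The subtractions on nat are never truncated when this holds: truncation in either one
   contradicts k + 1 \<le> a or 1 \<le> b. *)
definition is_F0 :: "nat \<Rightarrow> nat \<Rightarrow> nat \<Rightarrow> 'a graph \<Rightarrow> bool" where
  "is_F0 n k s G \<longleftrightarrow> is_Z0 n k (n + s - k - 1) (k + 1 - s) G"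

lemma eigenvalue_adjacency_matrix_iff:
  assumes "distinct vs" and V: "set vs = V"
  shows "eigenvalue (adjacency_matrix E vs) x \<longleftrightarrow>
    (\<exists>f. (\<exists>v\<in>V. f v \<noteq> 0) \<and>
         (\<forall>v\<in>V. (\<Sum>w\<in>V. if {v, w} \<in> E then f w else 0) = x * f v))"
proof -
  let ?n = "length vs"
  let ?A = "adjacency_matrix E vs"
  have bij: "bij_betw ((!) vs) {0..<?n} V"
    using bij_betw_nth[OF assms(1), of "{0..<?n}" V] V by (auto simp: lessThan_atLeast0)
  have dim: "?A \<in> carrier_mat ?n ?n" by (simp add: adjacency_matrix_def)
  have mult: "(?A *\<^sub>v y) $ i = (\<Sum>w\<in>V. if {vs ! i, w} \<in> E then f w else 0)"
    if "y \<in> carrier_vec ?n" "i < ?n" "\<And>j. j < ?n \<Longrightarrow> y $ j = f (vs ! j)" for y f i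
  proof -
    have "(?A *\<^sub>v y) $ i = (\<Sum>j\<in>{0..<?n}. if {vs ! i, vs ! j} \<in> E then f (vs ! j) else 0)"
      using that by (auto simp: adjacency_matrix_def scalar_prod_def intro!: sum.cong)
    also have "\<dots> = (\<Sum>w\<in>V. if {vs ! i, w} \<in> E then f w else 0)"
      by (rule sum.reindex_bij_betw[OF bij])
    finally show ?thesis .
  qed
  show ?thesis
  proof
    assume "eigenvalue ?A x"
    then obtain y where y: "y \<in> carrier_vec ?n" "y \<noteq> 0\<^sub>v ?n" "?A *\<^sub>v y = x \<cdot>\<^sub>v y"
      unfolding eigenvalue_def eigenvector_def using dim by auto
    define f where "f v = y $ (the_inv_into {0..<?n} ((!) vs) v)" for v
    have f: "f (vs ! j) = y $ j" if "j < ?n" for j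
      using that bij by (simp add: f_def the_inv_into_f_f bij_betw_def)
    obtain i where "i < ?n" "y $ i \<noteq> 0"
      using y(1,2) by (metis carrier_vecD eq_vecI index_zero_vec)
    then have "\<exists>v\<in>V. f v \<noteq> 0" using f V by (metis nth_mem)
    moreover have "(\<Sum>w\<in>V. if {v, w} \<in> E then f w else 0) = x * f v" if v: "v \<in> V" for v
    proof -
      obtain i where i: "i < ?n" "v = vs ! i" using v V by (metis in_set_conv_nth)
      have "(?A *\<^sub>v y) $ i = (\<Sum>w\<in>V. if {vs ! i, w} \<in> E then f w else 0)"
        using mult[OF y(1) i(1)] f by simp
      moreover have "(?A *\<^sub>v y) $ i = x * f v" using y i f by simp
      ultimately show ?thesis using i(2) by simp
    qed
    ultimately show "\<exists>f. (\<exists>v\<in>V. f v \<noteq> 0) \<and>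
         (\<forall>v\<in>V. (\<Sum>w\<in>V. if {v, w} \<in> E then f w else 0) = x * f v)" by blast
  next
    assume "\<exists>f. (\<exists>v\<in>V. f v \<noteq> 0) \<and>
         (\<forall>v\<in>V. (\<Sum>w\<in>V. if {v, w} \<in> E then f w else 0) = x * f v)"
    then obtain f v where f: "v \<in> V" "f v \<noteq> 0"
      "\<And>v. v \<in> V \<Longrightarrow> (\<Sum>w\<in>V. if {v, w} \<in> E then f w else 0) = x * f v" by blast
    define y where "y = vec ?n (\<lambda>j. f (vs ! j))"
    have y: "y \<in> carrier_vec ?n" by (simp add: y_def)
    obtain i where "i < ?n" "v = vs ! i" using f(1) V by (metis in_set_conv_nth)
    then have "y $ i \<noteq> 0\<^sub>v ?n $ i" using f(2) by (simp add: y_def)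
    then have "y \<noteq> 0\<^sub>v ?n" by metis
    moreover have "?A *\<^sub>v y = x \<cdot>\<^sub>v y"
    proof (rule eq_vecI)
      fix i assume "i < dim_vec (x \<cdot>\<^sub>v y)"
      then have i: "i < ?n" by (simp add: y_def)
      have "(?A *\<^sub>v y) $ i = (\<Sum>w\<in>V. if {vs ! i, w} \<in> E then f w else 0)"
        by (rule mult[OF y i]) (simp add: y_def)
      also have "\<dots> = x * f (vs ! i)" using f(3) i V by auto
      finally show "(?A *\<^sub>v y) $ i = (x \<cdot>\<^sub>v y) $ i" using i by (simp add: y_def)
    qed (simp add: y_def adjacency_matrix_def)
    ultimately show "eigenvalue ?A x"
      unfolding eigenvalue_def eigenvector_def using y dim by auto
  qed
qed

lemma spectrum_adjacency_matrix_unique: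
  assumes "distinct vs" "distinct ws" "set vs = set ws"
  shows "spectrum (adjacency_matrix E vs) = spectrum (adjacency_matrix E ws)"
  unfolding spectrum_def
  by (rule Collect_cong)
    (simp only: eigenvalue_adjacency_matrix_iff[OF assms(1,3)]
      eigenvalue_adjacency_matrix_iff[OF assms(2) refl])

lemma is_Z0_simple_graph:
  assumes "is_Z0 n k a b G"
  shows "simple_graph G"
proof -
  obtain X Y X1 Y1 u v where XY: "finite X" "finite Y" "X \<inter> Y = {}"
    and G: "G = (X \<union> Y, Z_edges X Y X1 Y1 - {{u, v}})"
    using assms unfolding is_Z0_def by auto
  have "\<exists>p\<in>X \<union> Y. \<exists>q\<in>X \<union> Y. p \<noteq> q \<and> e = {p, q}"
    if "e \<in> Z_edges X Y X1 Y1" for e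
  proof -
    obtain p q where "p \<in> X" "q \<in> Y" "e = {p, q}"
      using \<open>e \<in> Z_edges X Y X1 Y1\<close>
      unfolding Z_edges_def complete_bipartite_edges_def by blast
    then show ?thesis using XY(3) by (intro bexI[of _ p] bexI[of _ q]) auto
  qed
  then show ?thesis using XY unfolding simple_graph_def G by simp
qed

lemma is_Z0_exists:
  assumes "k < n" "k + 1 \<le> a" "1 \<le> b"
  shows "\<exists>G :: nat graph. is_Z0 n k a b G"
proof -
  let ?X = "{0..<n}" and ?Y = "{n..<n + (a + b)}"
  have "is_Z0 n k a b (?X \<union> ?Y, Z_edges ?X ?Y {k..<n} {n + a..<n + (a + b)} - {{n, k}})"
    unfolding is_Z0_def
    apply (intro conjI assms)
    apply (rule exI[of _ ?X], rule exI[of _ ?Y], rule exI[of _ "{k..<n}"],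
        rule exI[of _ "{n + a..<n + (a + b)}"], rule exI[of _ n], rule exI[of _ k])
    apply (intro conjI refl)
    using assms by auto
  then show ?thesis by blast
qed

end

theory Submission
  imports Defs
begin

text \<open>Write \<open>a = n + s - k - 1\<close> and \<open>b = k + 1 - s\<close>, so that \<open>n = a + b\<close>, and put
\<open>\<mu>\<^sup>2 = n a\<close>. Deleting the \<open>b\<close> vertices of \<open>Y1\<close> from the graph leaves \<open>K\<^bsub>n,a\<^esub>\<close> without
one edge. As \<open>\<rho>(K\<^bsub>n,a\<^esub>) = \<mu>\<close>, the question is whether removing the edge \<open>uv\<close> costs more than
the \<open>k b\<close> edges at \<open>Y1\<close> contribute.

This is decided by a Collatz--Wielandt argument (\<open>eigenvalue_less_if_supersolution\<close>): it is enough
to find a positive vertex weight \<open>g\<close> with \<open>A g \<le> \<mu> g\<close>, strictly on \<open>Y\<close>. Take \<open>g\<close> on \<open>Y\<close> to be a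
perturbation of the Perron weight of \<open>K\<^bsub>n,a\<^esub>\<close>, which is constant there, namely \<open>p\<close> on \<open>Y1\<close>, \<open>1 - q\<close> at \<open>u\<close>
and \<open>1\<close> elsewhere, and let \<open>g = A g / \<mu>\<close> on \<open>X\<close>, which gives equality there. On \<open>Y\<close> there are
then three inequalities, one for each of the values \<open>p\<close>, \<open>1\<close> and \<open>1 - q\<close>. The first one forces
\<open>p\<close> to be about \<open>k / n\<close>, the third one forces \<open>q\<close> to be at most about \<open>1 / n\<close>, and the second
one, \<open>k b p < 1 + (n - 1) q\<close>, then reads roughly \<open>k\<^sup>2 b / n < 2\<close>. Since \<open>b \<le> k + 1\<close>, this is
what \<open>n \<ge> (k\<^sup>2 + 4) (k + 1) / 2\<close> provides, with just enough room for the lower order terms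
(\<open>supersolution_parameters\<close>).

The radius \<open>\<rho>\<close> is a maximum over the real spectrum, so the spectrum also has to be nonempty; two
vertices of \<open>X1\<close> other than \<open>v\<close> have the same neighbours and so give the eigenvalue \<open>0\<close>.\<close>

section \<open>Bounding the largest eigenvalue by a supersolution\<close>

text \<open>Pair \<open>A g \<le> \<mu> g\<close> with the absolute value of an eigenvector \<open>f\<close>. If its eigenvalue were at
least \<open>\<mu>\<close>, all the inequalities would be tight wherever \<open>f\<close> lives, so \<open>f\<close> would vanish on \<open>S\<close>, and
hence also at every vertex whose neighbours all lie in \<open>S\<close>. Asking for strictness only on \<open>S\<close>
allows equality on one side of a bipartite graph.\<close>

lemma eigenvalue_less_if_supersolution:
  fixes g :: "'a \<Rightarrow> real"
  assumes vs: "distinct vs" "set vs = V"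
    and ev: "eigenvalue (adjacency_matrix E vs) x"
    and \<mu>: "0 < \<mu>"
    and pos: "\<And>v. v \<in> V \<Longrightarrow> 0 < g v"
    and le: "\<And>v. v \<in> V \<Longrightarrow> (\<Sum>w\<in>V. if {v, w} \<in> E then g w else 0) \<le> \<mu> * g v"
    and strict: "\<And>v. v \<in> S \<Longrightarrow> v \<in> V \<Longrightarrow> (\<Sum>w\<in>V. if {v, w} \<in> E then g w else 0) < \<mu> * g v"
    and indep: "\<And>v w. v \<in> V - S \<Longrightarrow> w \<in> V - S \<Longrightarrow> {v, w} \<notin> E"
  shows "x < \<mu>"
proof (rule ccontr)
  assume "\<not> x < \<mu>"
  then have x: "\<mu> \<le> x" "0 < x" using \<mu> by auto
  have fin: "finite V" using vs by auto
  obtain f z where z: "z \<in> V" "f z \<noteq> 0"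
    and f: "\<And>v. v \<in> V \<Longrightarrow> (\<Sum>w\<in>V. if {v, w} \<in> E then f w else 0) = x * f v"
    using ev eigenvalue_adjacency_matrix_iff[OF vs] by blast
  let ?Ag = "\<lambda>v. \<Sum>w\<in>V. if {v, w} \<in> E then g w else 0"
  have abs_f: "x * \<bar>f v\<bar> \<le> (\<Sum>w\<in>V. if {v, w} \<in> E then \<bar>f w\<bar> else 0)" if "v \<in> V" for v
  proof -
    have "x * \<bar>f v\<bar> = \<bar>\<Sum>w\<in>V. if {v, w} \<in> E then f w else 0\<bar>"
      using f[OF that] x by (simp add: abs_mult)
    also have "\<dots> \<le> (\<Sum>w\<in>V. \<bar>if {v, w} \<in> E then f w else 0\<bar>)" by (rule sum_abs)
    also have "\<dots> = (\<Sum>w\<in>V. if {v, w} \<in> E then \<bar>f w\<bar> else 0)" by (intro sum.cong) auto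
    finally show ?thesis .
  qed
  have "(\<Sum>v\<in>V. g v * (\<mu> * \<bar>f v\<bar>)) \<le> (\<Sum>v\<in>V. g v * (x * \<bar>f v\<bar>))"
    using x pos by (intro sum_mono mult_left_mono mult_right_mono) (auto simp: less_imp_le)
  also have "\<dots> \<le> (\<Sum>v\<in>V. g v * (\<Sum>w\<in>V. if {v, w} \<in> E then \<bar>f w\<bar> else 0))"
    using abs_f pos by (intro sum_mono mult_left_mono) (auto simp: less_imp_le)
  also have "\<dots> = (\<Sum>v\<in>V. \<Sum>w\<in>V. if {v, w} \<in> E then g v * \<bar>f w\<bar> else 0)"
    by (auto simp: sum_distrib_left intro!: sum.cong)
  also have "\<dots> = (\<Sum>w\<in>V. \<Sum>v\<in>V. if {v, w} \<in> E then g v * \<bar>f w\<bar> else 0)"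
    by (rule sum.swap)
  also have "\<dots> = (\<Sum>w\<in>V. \<bar>f w\<bar> * ?Ag w)"
    by (auto simp: sum_distrib_left insert_commute intro!: sum.cong)
  finally have "0 \<le> (\<Sum>v\<in>V. \<bar>f v\<bar> * ?Ag v) - (\<Sum>v\<in>V. g v * (\<mu> * \<bar>f v\<bar>))" by simp
  also have "\<dots> = - (\<Sum>v\<in>V. \<bar>f v\<bar> * (\<mu> * g v - ?Ag v))"
    by (simp add: sum_subtractf right_diff_distrib mult_ac)
  finally have "(\<Sum>v\<in>V. \<bar>f v\<bar> * (\<mu> * g v - ?Ag v)) \<le> 0" by simp
  moreover have nonneg: "0 \<le> \<bar>f v\<bar> * (\<mu> * g v - ?Ag v)" if "v \<in> V" for v
    using le[OF that] by simp
  ultimately have total: "(\<Sum>v\<in>V. \<bar>f v\<bar> * (\<mu> * g v - ?Ag v)) = 0"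
    by (meson antisym sum_nonneg)
  have tight: "\<bar>f v\<bar> * (\<mu> * g v - ?Ag v) = 0" if "v \<in> V" for v
    by (rule sum_nonneg_0[OF fin nonneg total that])
  have S: "f v = 0" if "v \<in> S" "v \<in> V" for v
    using tight[OF that(2)] strict[OF that] by auto
  have "f v = 0" if "v \<in> V" "v \<notin> S" for v
  proof -
    have "(\<Sum>w\<in>V. if {v, w} \<in> E then f w else 0) = 0"
      using S indep that by (intro sum.neutral) auto
    then show ?thesis using f[OF that(1)] x by simp
  qed
  then show False using z S by blast
qed

text \<open>The difference of the indicator functions of two such vertices is in the kernel of the
adjacency matrix.\<close>

lemma eigenvalue_0_if_twins:
  assumes vs: "distinct vs" "set vs = V"
    and xy: "x \<in> V" "y \<in> V" "x \<noteq> y"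
    and twins: "\<And>w. w \<in> V \<Longrightarrow> {w, x} \<in> E \<longleftrightarrow> {w, y} \<in> E"
  shows "eigenvalue (adjacency_matrix E vs) 0"
proof -
  define f :: "'a \<Rightarrow> real" where "f w = (if w = x then 1 else 0) - (if w = y then 1 else 0)" for w
  have fin: "finite V" using vs by auto
  have "(\<Sum>w\<in>V. if {v, w} \<in> E then f w else 0) = 0 * f v" if "v \<in> V" for v
  proof -
    have "(\<Sum>w\<in>V. if {v, w} \<in> E then f w else 0) =
        (\<Sum>w\<in>V. (if w = x then if {v, x} \<in> E then 1 else 0 else 0)
          - (if w = y then if {v, y} \<in> E then 1 else 0 else 0))"
      by (intro sum.cong) (auto simp: f_def)
    also have "\<dots> = 0" using fin xy twins[OF that] by (simp add: sum_subtractf)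
    finally show ?thesis by simp
  qed
  moreover have "f x \<noteq> 0" using xy by (simp add: f_def)
  ultimately show ?thesis unfolding eigenvalue_adjacency_matrix_iff[OF vs] using xy(1) by blast
qed

lemma \<rho>_less_if_supersolution:
  fixes g :: "'a \<Rightarrow> real"
  assumes fin: "finite V"
    and xy: "x \<in> V" "y \<in> V" "x \<noteq> y"
    and twins: "\<And>w. w \<in> V \<Longrightarrow> {w, x} \<in> E \<longleftrightarrow> {w, y} \<in> E"
    and \<mu>: "0 < \<mu>"
    and pos: "\<And>v. v \<in> V \<Longrightarrow> 0 < g v"
    and le: "\<And>v. v \<in> V \<Longrightarrow> (\<Sum>w\<in>V. if {v, w} \<in> E then g w else 0) \<le> \<mu> * g v"
    and strict: "\<And>v. v \<in> S \<Longrightarrow> v \<in> V \<Longrightarrow> (\<Sum>w\<in>V. if {v, w} \<in> E then g w else 0) < \<mu> * g v"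
    and indep: "\<And>v w. v \<in> V - S \<Longrightarrow> w \<in> V - S \<Longrightarrow> {v, w} \<notin> E"
  shows "\<rho> (V, E) < \<mu>"
proof -
  define vs where "vs = (SOME vs. distinct vs \<and> set vs = V)"
  have vs: "distinct vs" "set vs = V"
    using someI_ex[of "\<lambda>vs. distinct vs \<and> set vs = V"] finite_distinct_list[OF fin]
    unfolding vs_def by blast+
  let ?A = "adjacency_matrix E vs"
  have "?A \<in> carrier_mat (length vs) (length vs)" by (simp add: adjacency_matrix_def)
  then have "finite (spectrum ?A)" using card_finite_spectrum(1) by blast
  moreover have "0 \<in> spectrum ?A"
    using eigenvalue_0_if_twins[OF vs xy twins] by (simp add: spectrum_def)
  moreover have "t < \<mu>" if "t \<in> spectrum ?A" for t
    using eigenvalue_less_if_supersolution[OF vs _ \<mu> pos le strict indep] that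
    by (simp add: spectrum_def)
  ultimately have "Max (spectrum ?A) < \<mu>" using Max_in by blast
  then show ?thesis by (simp add: \<rho>_def vs_def)
qed

section \<open>The weights\<close>

text \<open>Write \<open>P = k b p\<close>. The choice \<open>p = k a / (n a - k b)\<close> satisfies the first inequality for
every \<open>q > 0\<close>. The other two then confine \<open>q\<close> to an interval, which is nonempty if and only if
\<open>P n a < 2 n a - n - a + 1\<close>. Multiply this by \<open>n a - k b\<close> and use
\<open>k\<^sup>2 b \<le> 2 n - 4 (k + 1)\<close> on the left: the two sides then differ by at least
\<open>n a ((4 k + 2) a - (2 k + 1) b + 1)\<close>, which is positive because \<open>b \<le> k + 1 \<le> a\<close>.\<close>

lemma supersolution_parameters:
  fixes n a b k :: real
  assumes n: "n = a + b" and b: "1 \<le> b" "b \<le> k + 1" and k: "1 \<le> k" and a: "k + 1 \<le> a"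
    and large: "(k\<^sup>2 + 4) * (k + 1) / 2 \<le> n"
  obtains p q where "0 < p" "0 < q" "q < 1"
    "k * (b * p + a - q) < n * a * p"
    "k * b * p < 1 + (n - 1) * q"
    "k * b * p < a - q * (n * a - n + 1)"
proof -
  define N where "N = n * a - k * b"
  define P where "P = k\<^sup>2 * b * a / N"
  define D where "D = n * (a - 1) + 1"
  have "k * b \<le> a * b" using a b by (intro mult_right_mono) auto
  moreover have "0 < a * a" using a k by simp
  ultimately have N: "0 < N" unfolding N_def n by (simp add: algebra_simps)
  have na: "0 < n * a" using n a b k by simp
  have D: "0 < D" unfolding D_def using n a b k by (intro add_nonneg_pos mult_nonneg_nonneg) auto
  have P0: "0 \<le> P" unfolding P_def using N k b a by simp
  have key: "P * (n * a) < 2 * n * a - n - a + 1"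
  proof -
    have "k\<^sup>2 * b \<le> k\<^sup>2 * (k + 1)" using b by (intro mult_left_mono) auto
    also have "\<dots> \<le> 2 * n - 4 * (k + 1)" using large by (simp add: algebra_simps)
    finally have "k\<^sup>2 * b * a * (n * a) \<le> (2 * n - 4 * (k + 1)) * a * (n * a)"
      using a k na by (intro mult_right_mono) auto
    also have "\<dots> < (2 * n * a - n - a + 1) * N"
    proof -
      have rem: "0 < 4 * (k + 1) * a - 2 * k * b - n - a + 1"
      proof -
        have "(2 * k + 1) * b \<le> (2 * k + 1) * (2 * a)"
          using a b k by (intro mult_left_mono) auto
        then show ?thesis unfolding n by (simp add: algebra_simps)
      qed
      have "0 \<le> k * b * (n + a - 1)" using k b a n by simp
      moreover have "0 < n * a * (4 * (k + 1) * a - 2 * k * b - n - a + 1)"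
        using rem na by simp
      moreover have "(2 * n * a - n - a + 1) * N - (2 * n - 4 * (k + 1)) * a * (n * a) =
          n * a * (4 * (k + 1) * a - 2 * k * b - n - a + 1) + k * b * (n + a - 1)"
        unfolding N_def by (simp add: algebra_simps power2_eq_square)
      ultimately show ?thesis by linarith
    qed
    finally show ?thesis unfolding P_def using N by (simp add: field_simps)
  qed
  have "P < a"
  proof -
    have "P * (n * a) < a * (n * a)"
    proof -
      have "2 * (n * a) \<le> a * (n * a)" using a k na by (intro mult_right_mono) auto
      then show ?thesis using key n a b k by linarith
    qed
    then show ?thesis using na mult_less_cancel_right_pos by blast
  qed
  then have "0 < (a - P) / D" using D by simp
  moreover have "(P - 1) / (n - 1) < (a - P) / D"
  proof -
    have "0 < n - 1" using n a b k by simp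
    moreover have "(P - 1) * D < (a - P) * (n - 1)"
      using key unfolding D_def by (simp add: algebra_simps)
    ultimately show ?thesis using D by (simp add: divide_simps)
  qed
  ultimately obtain q where q: "0 < q" "(P - 1) / (n - 1) < q" "q < (a - P) / D"
    using dense[of "max 0 ((P - 1) / (n - 1))" "(a - P) / D"] by auto
  show thesis
  proof (rule that)
    show "0 < k * a / N" using k a N by simp
    show "0 < q" by (rule q)
    have "0 < (n - 1) * (a - 1)" using n a b k by simp
    then have "(a - P) / D < 1" using D P0 unfolding D_def by (simp add: algebra_simps)
    then show "q < 1" using q by simp
    have P: "k * b * (k * a / N) = P" unfolding P_def by (simp add: power2_eq_square)
    have "n * a * (k * a / N) - k * (b * (k * a / N) + a) = N * (k * a) / N - k * a"
      unfolding N_def by (simp add: algebra_simps diff_divide_distrib)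
    also have "\<dots> = 0" using N by simp
    finally show "k * (b * (k * a / N) + a - q) < n * a * (k * a / N)"
      using q k by (simp add: right_diff_distrib)
    show "k * b * (k * a / N) < 1 + (n - 1) * q"
      unfolding P using q(2) n a b k by (simp add: field_simps)
    show "k * b * (k * a / N) < a - q * (n * a - n + 1)"
      unfolding P using q(3) D unfolding D_def by (simp add: field_simps)
  qed
qed

section \<open>The graph\<close>

lemma sum_if_neighbours:
  fixes g :: "'a \<Rightarrow> real"
  assumes "finite V" "N \<subseteq> V" "\<And>w. w \<in> V \<Longrightarrow> {v, w} \<in> E \<longleftrightarrow> w \<in> N"
  shows "(\<Sum>w\<in>V. if {v, w} \<in> E then g w else 0) = sum g N"
proof -
  have "(\<Sum>w\<in>V. if {v, w} \<in> E then g w else 0) = (\<Sum>w\<in>V. if w \<in> N then g w else 0)"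
    using assms(3) by (intro sum.cong) auto
  also have "\<dots> = sum g (V \<inter> N)" using assms(1) by (simp add: sum.inter_restrict)
  finally show ?thesis using assms(2) by (simp add: Int_absorb1)
qed

lemma Z0_edge_iff:
  assumes "X \<inter> Y = {}" "X1 \<subseteq> X" "Y1 \<subseteq> Y" "x \<in> X" "y \<in> Y" "u \<in> Y" "v \<in> X"
  shows "{x, y} \<in> Z_edges X Y X1 Y1 - {{u, v}} \<longleftrightarrow>
    \<not> (x \<in> X1 \<and> y \<in> Y1) \<and> \<not> (x = v \<and> y = u)"
proof -
  have "{x, y} \<in> complete_bipartite_edges A B \<longleftrightarrow> x \<in> A \<and> y \<in> B" if "A \<subseteq> X" "B \<subseteq> Y" for A B
  proof
    assume "{x, y} \<in> complete_bipartite_edges A B"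
    then obtain p q where "p \<in> A" "q \<in> B" "{x, y} = {p, q}"
      unfolding complete_bipartite_edges_def by blast
    moreover from this have "y \<noteq> p" using assms that by blast
    ultimately show "x \<in> A \<and> y \<in> B" by (simp add: doubleton_eq_iff)
  qed (auto simp: complete_bipartite_edges_def)
  moreover have "{x, y} = {u, v} \<longleftrightarrow> x = v \<and> y = u"
    using assms(1,4,6) by (auto simp: doubleton_eq_iff)
  ultimately show ?thesis using assms(2-5) unfolding Z_edges_def by simp
qed

lemma Z0_no_edge:
  assumes "X \<inter> Y = {}" "x \<in> X \<and> y \<in> X \<or> x \<in> Y \<and> y \<in> Y"
  shows "{x, y} \<notin> Z_edges X Y X1 Y1 - F"
proof
  assume "{x, y} \<in> Z_edges X Y X1 Y1 - F"
  then obtain p q where "p \<in> X" "q \<in> Y" "{x, y} = {p, q}"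
    unfolding Z_edges_def complete_bipartite_edges_def by blast
  then show False using assms unfolding doubleton_eq_iff by blast
qed

text \<open>Here \<open>n = a + b\<close> makes the two sides equally large. The three inequalities on the
parameters are \<open>A g < \<mu> g\<close>, multiplied by \<open>\<mu>\<close>, at the vertices of \<open>Y1\<close>, at those of \<open>Y\<close>
other than \<open>u\<close> outside \<open>Y1\<close>, and at \<open>u\<close>, in this order.\<close>

lemma \<rho>_Z0_less:
  assumes G: "is_Z0 n k a b G" and n: "n = a + b" and b: "b \<le> k + 1" and k: "1 \<le> k"
    and large: "((real k)\<^sup>2 + 4) * (real k + 1) / 2 \<le> real n"
  shows "\<rho> G < sqrt (real n * real a)"
proof -
  obtain X Y X1 Y1 u v where fin: "finite X" "finite Y" and disj: "X \<inter> Y = {}"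
    and card: "card X = n" "card Y = a + b" "card X1 = n - k" "card Y1 = b"
    and X1: "X1 \<subseteq> X" and Y1: "Y1 \<subseteq> Y" and u: "u \<in> Y - Y1" and v: "v \<in> X1"
    and G_eq: "G = (X \<union> Y, Z_edges X Y X1 Y1 - {{u, v}})"
    and kn: "k < n" and a: "k + 1 \<le> a" and b1: "1 \<le> b"
    using G unfolding is_Z0_def by auto
  have "real n = real a + real b" "1 \<le> real b" "real b \<le> real k + 1" "1 \<le> real k"
    "real k + 1 \<le> real a"
    using n b b1 k a by simp_all
  from supersolution_parameters[OF this large]
  obtain p q where pq: "0 < p" "0 < q" "q < 1"
    and ineq1: "real k * (real b * p + real a - q) < real n * real a * p"
    and ineq2: "real k * real b * p < 1 + (real n - 1) * q"
    and ineq3: "real k * real b * p < real a - q * (real n * real a - real n + 1)"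
    by blast
  define V where "V = X \<union> Y"
  define E where "E = Z_edges X Y X1 Y1 - {{u, v}}"
  define \<mu> where "\<mu> = sqrt (real n * real a)"
  have \<mu>: "0 < \<mu>" "\<mu> * \<mu> = real n * real a" unfolding \<mu>_def using kn a by simp_all
  \<comment> \<open>\<open>h\<close> is the weight on \<open>Y\<close>, and \<open>z x\<close> is the sum of \<open>h\<close> over the neighbours of \<open>x\<close>; dividing
    it by \<open>\<mu>\<close> gives the weight on \<open>X\<close> for which equality holds there.\<close>
  define h where "h y = (if y \<in> Y1 then p else if y = u then 1 - q else 1)" for y
  define z where "z x = (if x \<notin> X1 then b * p + a - q else if x = v then real a - 1 else a - q)" for x
  define g where "g w = (if w \<in> Y then h w else z w / \<mu>)" for w
  have finV: "finite V" unfolding V_def using fin by simp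
  have uY: "u \<in> Y" "u \<notin> Y1" and vX: "v \<in> X" using u v X1 by auto
  have fin1: "finite X1" "finite Y1" using X1 Y1 fin finite_subset by auto
  have cX: "real (card X1) = real n - real k" using card kn by simp
  have edge: "{x, y} \<in> E \<longleftrightarrow> \<not> (x \<in> X1 \<and> y \<in> Y1) \<and> \<not> (x = v \<and> y = u)"
    if "x \<in> X" "y \<in> Y" for x y
    unfolding E_def using Z0_edge_iff[OF disj X1 Y1 that uY(1) vX] .
  have edge': "{y, x} \<in> E \<longleftrightarrow> \<not> (x \<in> X1 \<and> y \<in> Y1) \<and> \<not> (x = v \<and> y = u)"
    if "x \<in> X" "y \<in> Y" for x y
    using edge[OF that] by (simp add: insert_commute)
  have no_edge: "{x, y} \<notin> E" if "x \<in> X \<and> y \<in> X \<or> x \<in> Y \<and> y \<in> Y" for x y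
    unfolding E_def by (rule Z0_no_edge[OF disj that])
  have h_pos: "0 < h y" for y using pq unfolding h_def by simp
  have z_pos: "0 < z x" for x
  proof -
    have "0 < real a - 1" using a k by simp
    moreover from this have "0 < real a - q" using pq by linarith
    moreover from this have "0 < b * p + real a - q"
      using pq mult_nonneg_nonneg[of "real b" p] by linarith
    ultimately show ?thesis unfolding z_def by presburger
  qed
  have sum_Y1: "sum h Y1 = b * p"
    using card(4) by (simp add: h_def)
  have sum_Y0: "sum h (Y - Y1 - {u}) = real a - 1"
  proof -
    have "sum h (Y - Y1 - {u}) = (\<Sum>y\<in>Y - Y1 - {u}. 1)" by (intro sum.cong) (auto simp: h_def)
    moreover have "card (Y - Y1 - {u}) = a - 1"
      using u Y1 fin1 fin card by (simp add: card_Diff_subset)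
    ultimately show ?thesis using a by simp
  qed
  have sum_Yu: "sum h (Y - Y1) = a - q"
    using sum.remove[of "Y - Y1" u h] u fin sum_Y0 uY by (simp add: h_def)
  have sum_Y: "sum h Y = b * p + a - q"
    using sum.subset_diff[OF Y1 fin(2), of h] sum_Y1 sum_Yu by simp
  have sum_X0: "sum z (X - X1) = k * (b * p + a - q)"
  proof -
    have "card (X - X1) = k" using X1 fin1 card kn by (simp add: card_Diff_subset)
    then show ?thesis by (simp add: z_def)
  qed
  have sum_X1: "sum z (X1 - {v}) = (real n - real k - 1) * (a - q)"
  proof -
    have "sum z (X1 - {v}) = (\<Sum>x\<in>X1 - {v}. a - q)" by (intro sum.cong) (auto simp: z_def)
    moreover have "real (card (X1 - {v})) = real n - real k - 1"
      using v fin1 card kn by (simp add: of_nat_diff)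
    ultimately show ?thesis by simp
  qed
  have sum_Xv: "sum z (X - {v}) = k * (b * p + a - q) + (real n - real k - 1) * (a - q)"
  proof -
    have "sum z (X - {v}) = sum z (X - {v} - (X1 - {v})) + sum z (X1 - {v})"
      using X1 fin by (intro sum.subset_diff) auto
    moreover have "X - {v} - (X1 - {v}) = X - X1" using v by auto
    ultimately show ?thesis using sum_X0 sum_X1 by simp
  qed
  have sum_X: "sum z X = k * (b * p + a - q) + (real n - real k - 1) * (a - q) + (real a - 1)"
    using sum.remove[OF fin(1) vX, of z] sum_Xv v by (simp add: z_def)
  have A_X: "(\<Sum>w\<in>V. if {x, w} \<in> E then g w else 0) = z x" if x: "x \<in> X" for x
  proof -
    define N where "N = (if x \<notin> X1 then Y else if x = v then Y - Y1 - {u} else Y - Y1)"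
    have "N \<subseteq> Y" unfolding N_def by auto
    moreover have "{x, w} \<in> E \<longleftrightarrow> w \<in> N" if "w \<in> V" for w
    proof (cases "w \<in> Y")
      case True
      then show ?thesis using edge[OF x True] v unfolding N_def by auto
    next
      case False
      then show ?thesis using no_edge x that \<open>N \<subseteq> Y\<close> unfolding V_def by auto
    qed
    ultimately have "(\<Sum>w\<in>V. if {x, w} \<in> E then g w else 0) = sum g N"
      by (intro sum_if_neighbours finV) (auto simp: V_def)
    also have "\<dots> = sum h N" using \<open>N \<subseteq> Y\<close> by (intro sum.cong) (auto simp: g_def)
    also have "\<dots> = z x" unfolding N_def z_def using sum_Y sum_Y0 sum_Yu by simp
    finally show ?thesis .
  qed
  have A_Y: "(\<Sum>w\<in>V. if {y, w} \<in> E then g w else 0) < \<mu> * h y" if y: "y \<in> Y" for y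
  proof -
    define N where "N = (if y \<in> Y1 then X - X1 else if y = u then X - {v} else X)"
    have "N \<subseteq> X" unfolding N_def by auto
    moreover have "{y, w} \<in> E \<longleftrightarrow> w \<in> N" if "w \<in> V" for w
    proof (cases "w \<in> X")
      case True
      then show ?thesis using edge'[OF True y] u unfolding N_def by auto
    next
      case False
      then show ?thesis using no_edge y that \<open>N \<subseteq> X\<close> unfolding V_def by auto
    qed
    ultimately have "(\<Sum>w\<in>V. if {y, w} \<in> E then g w else 0) = sum g N"
      by (intro sum_if_neighbours finV) (auto simp: V_def)
    also have "\<dots> = (\<Sum>w\<in>N. z w / \<mu>)"
      using \<open>N \<subseteq> X\<close> disj by (intro sum.cong) (auto simp: g_def)
    also have "\<dots> = sum z N / \<mu>" by (simp add: sum_divide_distrib)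
    also have "sum z N < real n * real a * h y"
    proof -
      consider "y \<in> Y1" | "y = u" "y \<notin> Y1" | "y \<notin> Y1" "y \<noteq> u" by blast
      then show ?thesis
      proof cases
        case 1
        then show ?thesis using ineq1 by (simp add: N_def h_def sum_X0)
      next
        case 2
        then show ?thesis using ineq3 by (simp add: N_def h_def sum_Xv algebra_simps)
      next
        case 3
        then show ?thesis using ineq2 by (simp add: N_def h_def sum_X algebra_simps)
      qed
    qed
    then have "sum z N / \<mu> < real n * real a * h y / \<mu>" using \<mu>(1) by (simp add: divide_strict_right_mono)
    also have "\<dots> = \<mu> * h y" unfolding \<mu>(2)[symmetric] using \<mu>(1) by simp
    finally show ?thesis .
  qed
  \<comment> \<open>Two twins are needed, and \<open>v\<close> is no twin of the other vertices of \<open>X1\<close>.\<close>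
  have "2 \<le> card (X1 - {v})"
  proof -
    have "5 * (real k + 1) \<le> ((real k)\<^sup>2 + 4) * (real k + 1)"
      using k by (intro mult_right_mono) (auto simp: one_le_power)
    then have "5 * (real k + 1) / 2 \<le> real n"
      by (rule order_trans[OF divide_right_mono large]) simp
    then have "k + 3 \<le> n" using k by simp
    then show ?thesis using v fin1 card by simp
  qed
  then obtain x x' where x: "x \<in> X1 - {v}" "x' \<in> X1 - {v}" "x \<noteq> x'"
    by (metis card_le_Suc0_iff_eq finite_Diff fin1(1) not_less_eq_eq numeral_2_eq_2)
  have xX: "x \<in> X" "x' \<in> X" using x X1 by auto
  have "\<rho> (V, E) < \<mu>"
  proof (rule \<rho>_less_if_supersolution[where S = Y and g = g])
    show "x \<in> V" "x' \<in> V" using xX by (auto simp: V_def)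
    show "{w, x} \<in> E \<longleftrightarrow> {w, x'} \<in> E" if "w \<in> V" for w
    proof (cases "w \<in> X")
      case True
      then show ?thesis using no_edge xX by blast
    next
      case False
      then have w: "w \<in> Y" using that by (simp add: V_def)
      show ?thesis using edge'[OF xX(1) w] edge'[OF xX(2) w] x by auto
    qed
    show "0 < g w" if "w \<in> V" for w
      using h_pos z_pos \<mu> by (simp add: g_def)
    show strict: "(\<Sum>w\<in>V. if {y, w} \<in> E then g w else 0) < \<mu> * g y" if "y \<in> Y" "y \<in> V" for y
      using A_Y[OF that(1)] that by (simp add: g_def)
    show "(\<Sum>w\<in>V. if {y, w} \<in> E then g w else 0) \<le> \<mu> * g y" if "y \<in> V" for y
    proof (cases "y \<in> Y")
      case True
      then show ?thesis using strict that by (simp add: less_imp_le)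
    next
      case False
      then show ?thesis using A_X[of y] that \<mu>(1) by (simp add: g_def V_def)
    qed
    show "{y, w} \<notin> E" if "y \<in> V - Y" "w \<in> V - Y" for y w
      using no_edge that by (auto simp: V_def)
  qed (use finV x \<mu> in auto)
  then show ?thesis unfolding G_eq V_def E_def \<mu>_def .
qed

theorem proposition1p17:
  fixes n k s :: nat and G :: "'a graph"
  assumes "real n \<ge> max ((real k ^ 2 + 4) * (real k + 1) / 2)
                        ((real k + 1) * (real k - real s + 2) + 2)"
    and "k \<ge> max s 1"
    and "is_F0 n k s G"
  shows "\<rho> G < sqrt (real n * (real n + real s - real k - 1))"
proof -
  have G: "is_Z0 n k (n + s - k - 1) (k + 1 - s) G" using assms(3) by (simp add: is_F0_def)
  then have kn: "k < n" "k + 1 \<le> n + s - k - 1" by (simp_all add: is_Z0_def)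
  have "n = (n + s - k - 1) + (k + 1 - s)" using kn assms(2) by linarith
  then have "\<rho> G < sqrt (real n * real (n + s - k - 1))"
    using \<rho>_Z0_less[OF G] assms by auto
  moreover have "real (n + s - k - 1) = real n + real s - real k - 1"
    using kn by linarith
  ultimately show ?thesis by (simp only:)
qed

end
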